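(* Let $(X,d)$ be a geodetic metric space, let $\ell$ be a real number with $0<\ell<m_X$, and let $n\ge 0$ be an integer. Then $$H_n^{\Sigma,\ell}(X)\simeq\bigoplus_{F}\mathbb{Z}\cdot\langle F\rangle,$$ where the direct sum is over all $F\in P_n^{\ell}(X)$ that are thin frames; that is, $H_n^{\Sigma,\ell}(X)$ is isomorphic to the free abelian group on the set of thin frames in $P_n^{\ell}(X)$.
   Context: Let $(X,d)$ be a metric space. For $x,y,z\in X$ write $x\preceq y\preceq z$ if $d(x,y)+d(y,z)=d(x,z)$, and $x\prec y\prec z$ if moreover $x\neq y$ and $y\neq z$. A tuple $\boldsymbol{x}=(x_0,\dots,x_n)\in X^{n+1}$ is a proper chain of degree $n$ if $x_{i-1}\neq x_i$ for all $i=1,\dots,n$; its length is $|\boldsymbol{x}|=\sum_{i=1}^n d(x_{i-1},x_i)$. $P_n(X)$ is the set of proper chains of degree $n$, and $P_n^{\ell}(X)$ is the set of those of length $\ell$. A $4$-cut of $X$ is $(x_0,x_1,x_2,x_3)\in P_3(X)$ with $x_0\prec x_1\prec x_2$, $x_1\prec x_2\prec x_3$ and $d(x_0,x_3)<|(x_0,x_1,x_2,x_3)|$. $m_X$ is the infimum of the lengths of all $4$-cuts of $X$, with $m_X=+\infty$ if there are none. For $a,b\in X$, $I_X(a,b):=\{x\in X\mid a\prec x\prec b\}$ is a poset with $x\le y$ iff $a\neq x$ and $d(a,x)+d(x,y)=d(a,y)$. $X$ is geodetic if $I_X(a,b)$ is totally ordered (or empty) for all $a,b\in X$. The magnitude chain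 complex in grading $\ell$ is $B_n^{\ell}(X)=\bigoplus_{\boldsymbol{x}\in P_n^{\ell}(X)}\mathbb{Z}\cdot\langle\boldsymbol{x}\rangle$ with boundary $\partial_n=\sum_i(-1)^i\partial_{n,i}$, where $\partial_{n,i}\langle x_0,\dots,x_n\rangle=\langle x_0,\dots,\widehat{x_i},\dots,x_n\rangle$ if $1\le i\le n-1$ and $x_{i-1}\prec x_i\prec x_{i+1}$, and $0$ otherwise. Its homology is the magnitude homology $H_n^{\Sigma,\ell}(X)$. For $\boldsymbol{x}=(x_0,\dots,x_n)\in P_n(X)$, the point $x_i$ is smooth if $1\le i\le n-1$ and $x_{i-1}\prec x_i\prec x_{i+1}$, and singular otherwise. The frame $\varphi(\boldsymbol{x})$ is the tuple of all singular points of $\boldsymbol{x}$, in order. A chain $F=(a_0,\dots,a_m)\in P_m(X)$ is a thin frame if $\varphi(F)=F$ and $I_X(a_{i-1},a_i)=\emptyset$ for all $i=1,\dots,m$. *)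

theory Defs
  imports
    "HOL-Analysis.Abstract_Metric_Spaces"
    "HOL-Library.Extended_Real"
    "HOL-Algebra.Free_Abelian_Groups"
begin

text \<open>
  A metric space is a carrier set \<open>X\<close> with a distance function \<open>d\<close> satisfying \<^locale>\<open>Metric_space\<close>.
  A tuple \<open>(x_0, ..., x_n)\<close> is the list of length \<open>n + 1\<close> with these entries.
\<close>

text \<open>The strict relation \<open>x \<prec> y \<prec> z\<close>.\<close>

definition strictly_between :: "('a \<Rightarrow> 'a \<Rightarrow> real) \<Rightarrow> 'a \<Rightarrow> 'a \<Rightarrow> 'a \<Rightarrow> bool"
  where "strictly_between d x y z \<longleftrightarrow> d x y + d y z = d x z \<and> x \<noteq> y \<and> y \<noteq> z"

definition proper_chains :: "'a set \<Rightarrow> nat \<Rightarrow> 'a list set"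
  where "proper_chains X n =
    {xs. length xs = n + 1 \<and> set xs \<subseteq> X \<and> (\<forall>i\<in>{1..n}. xs ! (i - 1) \<noteq> xs ! i)}"

definition chain_length :: "('a \<Rightarrow> 'a \<Rightarrow> real) \<Rightarrow> 'a list \<Rightarrow> real"
  where "chain_length d xs = (\<Sum>i = 1..length xs - 1. d (xs ! (i - 1)) (xs ! i))"

definition proper_chains_of_length :: "'a set \<Rightarrow> ('a \<Rightarrow> 'a \<Rightarrow> real) \<Rightarrow> nat \<Rightarrow> real \<Rightarrow> 'a list set"
  where "proper_chains_of_length X d n l = {xs \<in> proper_chains X n. chain_length d xs = l}"

definition four_cuts :: "'a set \<Rightarrow> ('a \<Rightarrow> 'a \<Rightarrow> real) \<Rightarrow> 'a list set"
  where "four_cuts X d =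
    {xs \<in> proper_chains X 3.
       strictly_between d (xs ! 0) (xs ! 1) (xs ! 2) \<and>
       strictly_between d (xs ! 1) (xs ! 2) (xs ! 3) \<and>
       d (xs ! 0) (xs ! 3) < chain_length d xs}"

text \<open>The value is \<open>\<infinity>\<close> if there are no 4-cuts, since the infimum of the empty set in
  \<^typ>\<open>ereal\<close> is \<open>\<infinity>\<close>.\<close>

definition min_cut_length :: "'a set \<Rightarrow> ('a \<Rightarrow> 'a \<Rightarrow> real) \<Rightarrow> ereal"
  where "min_cut_length X d = (INF xs\<in>four_cuts X d. ereal (chain_length d xs))"

definition open_segment_of :: "'a set \<Rightarrow> ('a \<Rightarrow> 'a \<Rightarrow> real) \<Rightarrow> 'a \<Rightarrow> 'a \<Rightarrow> 'a set"
  where "open_segment_of X d a b = {x \<in> X. strictly_between d a x b}"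

definition segment_order :: "'a set \<Rightarrow> ('a \<Rightarrow> 'a \<Rightarrow> real) \<Rightarrow> 'a \<Rightarrow> 'a \<Rightarrow> 'a rel"
  where "segment_order X d a b =
    {(x, y). x \<in> open_segment_of X d a b \<and> y \<in> open_segment_of X d a b \<and>
             a \<noteq> x \<and> d a x + d x y = d a y}"

definition geodetic :: "'a set \<Rightarrow> ('a \<Rightarrow> 'a \<Rightarrow> real) \<Rightarrow> bool"
  where "geodetic X d \<longleftrightarrow>
    (\<forall>a\<in>X. \<forall>b\<in>X. linear_order_on (open_segment_of X d a b) (segment_order X d a b))"

definition smooth_at :: "('a \<Rightarrow> 'a \<Rightarrow> real) \<Rightarrow> 'a list \<Rightarrow> nat \<Rightarrow> bool"
  where "smooth_at d xs i \<longleftrightarrow>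
    1 \<le> i \<and> i + 1 < length xs \<and> strictly_between d (xs ! (i - 1)) (xs ! i) (xs ! (i + 1))"

definition frame :: "('a \<Rightarrow> 'a \<Rightarrow> real) \<Rightarrow> 'a list \<Rightarrow> 'a list"
  where "frame d xs = nths xs {i. \<not> smooth_at d xs i}"

definition thin_frame :: "'a set \<Rightarrow> ('a \<Rightarrow> 'a \<Rightarrow> real) \<Rightarrow> 'a list \<Rightarrow> bool"
  where "thin_frame X d F \<longleftrightarrow>
    (\<exists>m. F \<in> proper_chains X m \<and> frame d F = F \<and>
         (\<forall>i\<in>{1..m}. open_segment_of X d (F ! (i - 1)) (F ! i) = {}))"

definition magnitude_chain_group ::
    "'a set \<Rightarrow> ('a \<Rightarrow> 'a \<Rightarrow> real) \<Rightarrow> nat \<Rightarrow> real \<Rightarrow> ('a list \<Rightarrow>\<^sub>0 int) monoid"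
  where "magnitude_chain_group X d n l = free_Abelian_group (proper_chains_of_length X d n l)"

definition magnitude_face :: "('a \<Rightarrow> 'a \<Rightarrow> real) \<Rightarrow> nat \<Rightarrow> 'a list \<Rightarrow> ('a list \<Rightarrow>\<^sub>0 int)"
  where "magnitude_face d i xs =
    (if smooth_at d xs i then frag_of (take i xs @ drop (i + 1) xs) else 0)"

definition magnitude_boundary ::
    "('a \<Rightarrow> 'a \<Rightarrow> real) \<Rightarrow> nat \<Rightarrow> ('a list \<Rightarrow>\<^sub>0 int) \<Rightarrow> ('a list \<Rightarrow>\<^sub>0 int)"
  where "magnitude_boundary d n =
    frag_extend (\<lambda>xs. \<Sum>i\<le>n. frag_cmul ((-1) ^ i) (magnitude_face d i xs))"

text \<open>In degree 0 the boundary map vanishes, because the entry of a chain of degree 0 is never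
  smooth; so every chain of degree 0 is a cycle.\<close>

definition magnitude_cycles ::
    "'a set \<Rightarrow> ('a \<Rightarrow> 'a \<Rightarrow> real) \<Rightarrow> nat \<Rightarrow> real \<Rightarrow> ('a list \<Rightarrow>\<^sub>0 int) set"
  where "magnitude_cycles X d n l =
    {c \<in> carrier (magnitude_chain_group X d n l). magnitude_boundary d n c = 0}"

definition magnitude_boundaries ::
    "'a set \<Rightarrow> ('a \<Rightarrow> 'a \<Rightarrow> real) \<Rightarrow> nat \<Rightarrow> real \<Rightarrow> ('a list \<Rightarrow>\<^sub>0 int) set"
  where "magnitude_boundaries X d n l =
    magnitude_boundary d (n + 1) ` carrier (magnitude_chain_group X d (n + 1) l)"

definition magnitude_homology ::
    "'a set \<Rightarrow> ('a \<Rightarrow> 'a \<Rightarrow> real) \<Rightarrow> nat \<Rightarrow> real \<Rightarrow> ('a list \<Rightarrow>\<^sub>0 int) set monoid"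
  where "magnitude_homology X d n l =
    subgroup_generated (magnitude_chain_group X d n l) (magnitude_cycles X d n l)
      Mod magnitude_boundaries X d n l"

end

theory Submission
  imports Defs
begin

text \<open>
  A chain of length less than \<open>m_X\<close> contains no 4-cut, so deleting a smooth point does not change
  which of the remaining points are smooth, and the boundary map preserves frames. For a thin frame
  the only chain with this frame is the frame itself, and its boundary vanishes. For any other
  frame, take its first pair of consecutive points \<open>a\<close>, \<open>b\<close> with \<open>I_X(a, b)\<close> nonempty and fix a
  pivot \<open>p\<close> in \<open>I_X(a, b)\<close>. Since \<open>X\<close> is geodetic, every chain with this frame that avoids \<open>p\<close>
  between \<open>a\<close> and \<open>b\<close> extends by \<open>p\<close> there in exactly one way. Inserting \<open>p\<close> with the appropriate
  sign (and mapping the chains that already contain it to \<open>0\<close>) is a homotopy \<open>h\<close> with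
  \<open>\<partial> h + h \<partial> = id - \<pi>\<close>, where \<open>\<pi>\<close> is the projection onto the thin frames.
\<close>

subsection \<open>Deleting points of a chain\<close>

definition delete_at :: "nat \<Rightarrow> 'a list \<Rightarrow> 'a list"
  where "delete_at i xs = take i xs @ drop (Suc i) xs"

text \<open>The coface and codegeneracy maps of the simplex category, describing how positions change
  under \<^const>\<open>delete_at\<close>.\<close>

definition skip :: "nat \<Rightarrow> nat \<Rightarrow> nat"
  where "skip i k = (if k < i then k else Suc k)"

definition unskip :: "nat \<Rightarrow> nat \<Rightarrow> nat"
  where "unskip i k = (if k < i then k else k - 1)"

lemma length_delete_at: "i < length xs \<Longrightarrow> length (delete_at i xs) = length xs - 1"
  by (simp add: delete_at_def)

lemma nth_delete_at:
  "i < length xs \<Longrightarrow> Suc k < length xs \<Longrightarrow> delete_at i xs ! k = xs ! skip i k"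
  by (simp add: delete_at_def skip_def nth_append)

lemma delete_at_commute:
  assumes "i < j" "j < length xs"
  shows "delete_at i (delete_at j xs) = delete_at (j - 1) (delete_at i xs)"
  using assms
  by (intro nth_equalityI) (auto simp: length_delete_at nth_delete_at skip_def)

lemma delete_at_unskip:
  assumes "i \<noteq> j" "i < length xs" "j < length xs"
  shows "delete_at (unskip j i) (delete_at j xs) = delete_at (unskip i j) (delete_at i xs)"
proof (cases "i < j")
  case True
  then show ?thesis
    using delete_at_commute[of i j xs] assms by (simp add: unskip_def)
next
  case False
  then show ?thesis
    using delete_at_commute[of j i xs] assms by (simp add: unskip_def)
qed

lemma delete_at_inject:
  assumes "length xs = length ys" "i < length xs" "xs ! i = ys ! i"
    and "delete_at i xs = delete_at i ys"
  shows "xs = ys"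
  by (metis assms append_eq_append_conv delete_at_def id_take_nth_drop length_take)

lemma inj_skip: "inj (skip i)"
  by (auto simp: inj_def skip_def split: if_splits)

lemma unskip_skip [simp]: "unskip i (skip i k) = k"
  by (simp add: skip_def unskip_def)

lemma skip_unskip: "k \<noteq> i \<Longrightarrow> skip i (unskip i k) = k"
  by (auto simp: skip_def unskip_def)

lemma skip_neq [simp]: "skip i k \<noteq> i"
  by (simp add: skip_def)

section \<open>Lengths of chains, and the boundary as a sum over smooth positions\<close>

lemma chain_length_alt: "chain_length d xs = (\<Sum>i<length xs - 1. d (xs ! i) (xs ! Suc i))"
  by (simp add: chain_length_def sum.atLeast1_atMost_eq)

lemma chain_length_Cons: "chain_length d (x # y # zs) = d x y + chain_length d (y # zs)"
  by (simp add: chain_length_alt sum.lessThan_Suc_shift del: sum.lessThan_Suc)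

lemma chain_length_append:
  "chain_length d (us @ a # ws) = chain_length d (us @ [a]) + chain_length d (a # ws)"
proof (induction us)
  case Nil
  then show ?case by (simp add: chain_length_def)
next
  case (Cons u us)
  then show ?case by (cases us) (auto simp: chain_length_Cons)
qed

lemma smooth_at_less: "smooth_at d xs i \<Longrightarrow> Suc i < length xs"
  by (simp add: smooth_at_def)

lemma finite_smooth_at: "finite {i. smooth_at d xs i}"
  by (rule finite_subset[of _ "{..<length xs}"]) (auto dest: smooth_at_less)

lemma split_at_three:
  assumes "1 \<le> i" "Suc i < length xs"
  shows "xs = take (i - 1) xs @ xs ! (i - 1) # xs ! i # xs ! Suc i # drop (i + 2) xs"
proof -
  have "xs = take (i - 1) xs @ xs ! (i - 1) # drop i xs"
    using id_take_nth_drop[of "i - 1" xs] assms by simp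
  moreover have "drop i xs = xs ! i # xs ! Suc i # drop (i + 2) xs"
    using assms by (simp add: Cons_nth_drop_Suc)
  ultimately show ?thesis by simp
qed

lemma chain_length_delete_at:
  assumes "smooth_at d xs i"
  shows "chain_length d (delete_at i xs) = chain_length d xs"
proof -
  define us where "us = take (i - 1) xs"
  define a b c where "a = xs ! (i - 1)" "b = xs ! i" "c = xs ! Suc i"
  define ws where "ws = drop (i + 2) xs"
  have i: "1 \<le> i" "Suc i < length xs"
    using assms by (auto simp: smooth_at_def)
  have xs: "xs = us @ a # b # c # ws"
    using split_at_three[OF i] by (simp add: us_def a_b_c_def ws_def)
  have "length us = i - 1"
    using i by (simp add: us_def)
  then have del: "delete_at i xs = us @ a # c # ws"
    using i by (cases i) (simp_all add: xs delete_at_def)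
  have "d a b + d b c = d a c"
    using assms by (simp add: smooth_at_def strictly_between_def a_b_c_def)
  then show ?thesis
    unfolding del unfolding xs
    by (simp add: chain_length_append[of d us a "c # ws"] chain_length_append[of d us a "b # c # ws"]
        chain_length_Cons)
qed

text \<open>Summing over smooth positions only removes the degree from the formula, so one map
  serves all degrees.\<close>

definition face_sum :: "('a \<Rightarrow> 'a \<Rightarrow> real) \<Rightarrow> 'a list \<Rightarrow> 'a list \<Rightarrow>\<^sub>0 int"
  where "face_sum d xs = (\<Sum>i | smooth_at d xs i. frag_cmul ((-1) ^ i) (frag_of (delete_at i xs)))"

lemma magnitude_boundary_eq:
  assumes "Poly_Mapping.keys c \<subseteq> proper_chains_of_length X d n l"
  shows "magnitude_boundary d n c = frag_extend (face_sum d) c"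
  unfolding magnitude_boundary_def
proof (rule frag_extend_eq)
  fix xs assume "xs \<in> Poly_Mapping.keys c"
  then have "length xs = Suc n"
    using assms by (auto simp: proper_chains_of_length_def proper_chains_def)
  then have "smooth_at d xs i \<Longrightarrow> i \<le> n" for i
    by (auto dest: smooth_at_less)
  then show "(\<Sum>i\<le>n. frag_cmul ((-1) ^ i) (magnitude_face d i xs)) = face_sum d xs"
    unfolding face_sum_def
    by (intro sum.mono_neutral_cong_right) (auto simp: magnitude_face_def delete_at_def)
qed

text \<open>Exchanging the two indices shows that the sum equals its own negative, and integer
  combinations have no 2-torsion. This is the cancellation behind
  \<open>boundary_face_sum\<close>.\<close>

lemma sum_antisymmetric:
  fixes g :: "'b \<Rightarrow> 'b \<Rightarrow> 'c \<Rightarrow>\<^sub>0 int"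
  assumes "\<And>i j. i \<in> S \<Longrightarrow> j \<in> S \<Longrightarrow> g i j = - g j i"
  shows "(\<Sum>i\<in>S. \<Sum>j\<in>S. g i j) = 0"
proof -
  have "(\<Sum>i\<in>S. \<Sum>j\<in>S. g i j) = (\<Sum>i\<in>S. \<Sum>j\<in>S. - g j i)"
    by (intro sum.cong refl assms)
  also have "\<dots> = - (\<Sum>i\<in>S. \<Sum>j\<in>S. g j i)"
    by (simp add: sum_negf)
  also have "(\<Sum>i\<in>S. \<Sum>j\<in>S. g j i) = (\<Sum>i\<in>S. \<Sum>j\<in>S. g i j)"
    by (rule sum.swap)
  finally have "(\<Sum>i\<in>S. \<Sum>j\<in>S. g i j) + (\<Sum>i\<in>S. \<Sum>j\<in>S. g i j) = 0"
    by (simp only: eq_neg_iff_add_eq_0)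
  then have "frag_cmul 2 (\<Sum>i\<in>S. \<Sum>j\<in>S. g i j) = 0"
    using frag_cmul_distrib[of 1 1 "\<Sum>i\<in>S. \<Sum>j\<in>S. g i j"] by simp
  then show ?thesis by simp
qed

section \<open>Chains whose length lies below all 4-cut lengths, in a geodetic space\<close>

locale short_chains = Metric_space M d
  for M :: "'a set" and d :: "'a \<Rightarrow> 'a \<Rightarrow> real" +
  fixes l :: real
  assumes geodetic: "geodetic M d"
    and less_min_cut: "ereal l < min_cut_length M d"
begin

abbreviation chains :: "nat \<Rightarrow> 'a list set"
  where "chains n \<equiv> proper_chains_of_length M d n l"

abbreviation smooth :: "'a list \<Rightarrow> nat \<Rightarrow> bool"
  where "smooth \<equiv> smooth_at d"

abbreviation segment :: "'a \<Rightarrow> 'a \<Rightarrow> 'a set"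
  where "segment \<equiv> open_segment_of M d"

lemma chainsD:
  assumes "xs \<in> chains n"
  shows "length xs = Suc n" "i \<le> n \<Longrightarrow> xs ! i \<in> M" "i < n \<Longrightarrow> xs ! i \<noteq> xs ! Suc i"
    "chain_length d xs = l"
proof -
  show "length xs = Suc n" "chain_length d xs = l" "i \<le> n \<Longrightarrow> xs ! i \<in> M"
    using assms by (auto simp: proper_chains_of_length_def proper_chains_def)
  show "xs ! i \<noteq> xs ! Suc i" if "i < n"
  proof -
    have "\<forall>i\<in>{1..n}. xs ! (i - 1) \<noteq> xs ! i"
      using assms by (auto simp: proper_chains_of_length_def proper_chains_def)
    from bspec[OF this, of "Suc i"] that show ?thesis by simp
  qed
qed

lemma chainsI:
  assumes "length xs = Suc n" "\<And>i. i \<le> n \<Longrightarrow> xs ! i \<in> M" "\<And>i. i < n \<Longrightarrow> xs ! i \<noteq> xs ! Suc i"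
    "chain_length d xs = l"
  shows "xs \<in> chains n"
proof -
  have "xs ! (i - 1) \<noteq> xs ! i" if "i \<in> {1..n}" for i
    using assms(3)[of "i - 1"] that by (cases i) auto
  moreover have "set xs \<subseteq> M"
    using assms(1,2) by (auto simp: in_set_conv_nth)
  ultimately show ?thesis
    using assms by (auto simp: proper_chains_of_length_def proper_chains_def)
qed

lemma strictly_between_neq:
  assumes "strictly_between d x y z" "x \<in> M" "y \<in> M" "z \<in> M"
  shows "x \<noteq> z"
  using assms mdist_pos_less[of x y] mdist_pos_less[of y z] mdist_zero[of x]
  by (auto simp: strictly_between_def simp del: mdist_pos_eq zero)

subsection \<open>Chains without 4-cuts\<close>

text \<open>If additivity failed, \<open>[x, y, z, w]\<close> would be a 4-cut of length at most
  \<open>l\<close>, contradicting \<open>less_min_cut\<close>.\<close>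

lemma no_cut:
  assumes "x \<in> M" "y \<in> M" "z \<in> M" "w \<in> M"
    and "strictly_between d x y z" "strictly_between d y z w"
    and "d x y + d y z + d z w \<le> l"
  shows "d x w = d x y + d y z + d z w"
proof (rule ccontr)
  assume neq: "d x w \<noteq> d x y + d y z + d z w"
  let ?c = "[x, y, z, w]"
  have len: "chain_length d ?c = d x y + d y z + d z w"
    by (simp add: chain_length_def numeral_3_eq_3)
  have "d x w \<le> d x y + d y z + d z w"
    using assms triangle[of x z w] by (auto simp: strictly_between_def)
  moreover have "{1..3::nat} = {1,2,3}" by auto
  ultimately have "?c \<in> four_cuts M d"
    using assms neq len
    by (auto simp: four_cuts_def proper_chains_def strictly_between_def numeral_2_eq_2 numeral_3_eq_3)
  then have "min_cut_length M d \<le> ereal (chain_length d ?c)"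
    unfolding min_cut_length_def by (rule INF_lower)
  also have "\<dots> \<le> ereal l"
    using assms len by simp
  finally show False
    using less_min_cut by simp
qed

lemma delete_at_chains:
  assumes "xs \<in> chains (Suc n)" "smooth xs i"
  shows "delete_at i xs \<in> chains n"
proof (rule chainsI)
  note c = chainsD[OF assms(1)]
  have i: "1 \<le> i" "i < Suc n"
    using assms(2) c(1) by (auto simp: smooth_at_def)
  show "length (delete_at i xs) = Suc n"
    using c(1) i by (simp add: length_delete_at)
  show "chain_length d (delete_at i xs) = l"
    using chain_length_delete_at[OF assms(2)] c(4) by simp
  show "delete_at i xs ! k \<in> M" if "k \<le> n" for k
    using that c(1) c(2) i by (simp add: nth_delete_at skip_def)
  show "delete_at i xs ! k \<noteq> delete_at i xs ! Suc k" if "k < n" for k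
  proof (cases "Suc k = i")
    case True
    have "strictly_between d (xs ! k) (xs ! i) (xs ! Suc i)"
      using assms(2) True by (auto simp: smooth_at_def)
    then have "xs ! k \<noteq> xs ! Suc i"
      using strictly_between_neq c(2) i True by auto
    then show ?thesis
      using that c(1) i True by (simp add: nth_delete_at skip_def)
  next
    case False
    have "skip i (Suc k) = Suc (skip i k)" "skip i k < Suc n"
      using False that by (auto simp: skip_def)
    moreover have "delete_at i xs ! k = xs ! skip i k" "delete_at i xs ! Suc k = xs ! skip i (Suc k)"
      using that c(1) i by (simp_all add: nth_delete_at)
    ultimately show ?thesis
      using c(3)[of "skip i k"] by simp
  qed
qed

text \<open>Distances are nonnegative, so dropping terms cannot increase the sum. The bound makes
  \<open>no_cut\<close> applicable to any stretch of a chain.\<close>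

lemma partial_length_le:
  assumes "xs \<in> chains n" "k \<le> n"
  shows "(\<Sum>r = i..<k. d (xs ! r) (xs ! Suc r)) \<le> l"
proof -
  have "(\<Sum>r = i..<k. d (xs ! r) (xs ! Suc r)) \<le> (\<Sum>r<n. d (xs ! r) (xs ! Suc r))"
    using assms(2) by (intro sum_mono2) auto
  then show ?thesis
    using chainsD(1,4)[OF assms(1)] by (simp add: chain_length_alt)
qed

text \<open>If additivity first failed at \<open>k\<close>, then the points at positions \<open>i\<close>, \<open>k - 2\<close>, \<open>k - 1\<close>, \<open>k\<close>
  would form a 4-cut of length at most \<open>l\<close>.\<close>

lemma smooth_run_length:
  assumes "xs \<in> chains n" "i \<le> k" "k \<le> n" "\<And>r. i < r \<Longrightarrow> r < k \<Longrightarrow> smooth xs r"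
  shows "d (xs ! i) (xs ! k) = (\<Sum>r = i..<k. d (xs ! r) (xs ! Suc r))"
  using assms(2-4)
proof (induction k rule: less_induct)
  case (less k)
  note c = chainsD[OF assms(1)]
  let ?S = "\<lambda>k. \<Sum>r = i..<k. d (xs ! r) (xs ! Suc r)"
  consider "k = i" | "k = Suc i" | "Suc i < k"
    using less.prems(1) by linarith
  then show ?case
  proof cases
    case 1
    then show ?thesis using c(2) less.prems by simp
  next
    case 2
    then show ?thesis by simp
  next
    case lt: 3
    define m where "m = k - 2"
    have 3: "k = Suc (Suc m)" "i < Suc m"
      using lt by (auto simp: m_def)
    show ?thesis
    proof (cases "i = m")
      case True
      then have "smooth xs (Suc m)"
        using less.prems 3 by simp
      then show ?thesis
        using 3 True by (simp add: smooth_at_def strictly_between_def)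
    next
      case False
      with 3 have im: "i < m" by simp
      have 1: "d (xs ! i) (xs ! m) = ?S m" "d (xs ! i) (xs ! Suc m) = ?S (Suc m)"
        using less.IH[of m] less.IH[of "Suc m"] less.prems 3 im by auto
      have S: "?S (Suc m) = ?S m + d (xs ! m) (xs ! Suc m)"
        "?S k = ?S m + d (xs ! m) (xs ! Suc m) + d (xs ! Suc m) (xs ! k)"
        using im 3 by simp_all
      have sm: "smooth xs (Suc m)"
        using less.prems 3 by simp
      \<comment> \<open>The strict relation also needs \<open>xs ! i\<close> and
        \<open>xs ! m\<close> to differ; this follows from a positive sum, as additivity already
        holds up to \<open>m\<close>.\<close>
      have "0 < ?S m"
        using im c(2,3) less.prems 3 by (intro sum_pos) auto
      then have "xs ! i \<noteq> xs ! m"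
        using 1 c(2)[of m] less.prems 3 by auto
      then have "strictly_between d (xs ! i) (xs ! m) (xs ! Suc m)"
        using 1 S sm by (simp add: strictly_between_def smooth_at_def)
      moreover have "strictly_between d (xs ! m) (xs ! Suc m) (xs ! k)"
        using sm 3 by (simp add: smooth_at_def)
      moreover have "?S k \<le> l"
        by (rule partial_length_le[OF assms(1) less.prems(2)])
      ultimately have "d (xs ! i) (xs ! k) = d (xs ! i) (xs ! m) + d (xs ! m) (xs ! Suc m) + d (xs ! Suc m) (xs ! k)"
        using c(2) 3 less.prems 1 S by (intro no_cut) auto
      then show ?thesis
        using 1 S by simp
    qed
  qed
qed

lemma smooth_run_pos:
  assumes "xs \<in> chains n" "i < k" "k \<le> n" "\<And>r. i < r \<Longrightarrow> r < k \<Longrightarrow> smooth xs r"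
  shows "0 < d (xs ! i) (xs ! k)"
proof -
  have "0 < (\<Sum>r = i..<k. d (xs ! r) (xs ! Suc r))"
    using assms(2,3) chainsD(2,3)[OF assms(1)] by (intro sum_pos) auto
  then show ?thesis
    using smooth_run_length[OF assms(1) _ assms(3,4)] assms(2) by simp
qed

lemma smooth_run_between:
  assumes "xs \<in> chains n" "i < j" "j < k" "k \<le> n" "\<And>r. i < r \<Longrightarrow> r < k \<Longrightarrow> smooth xs r"
  shows "strictly_between d (xs ! i) (xs ! j) (xs ! k)"
proof -
  let ?S = "\<lambda>i k. \<Sum>r = i..<k. d (xs ! r) (xs ! Suc r)"
  have "?S i j + ?S j k = ?S i k"
    using assms(2,3) by (intro sum.atLeastLessThan_concat) auto
  then have "d (xs ! i) (xs ! j) + d (xs ! j) (xs ! k) = d (xs ! i) (xs ! k)"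
    using assms smooth_run_length[OF assms(1), of i j] smooth_run_length[OF assms(1), of j k]
      smooth_run_length[OF assms(1), of i k] by auto
  moreover have "xs ! i \<noteq> xs ! j" "xs ! j \<noteq> xs ! k"
    using assms smooth_run_pos[OF assms(1), of i j] smooth_run_pos[OF assms(1), of j k]
      chainsD(2)[OF assms(1), of j] by auto
  ultimately show ?thesis
    by (simp add: strictly_between_def)
qed

text \<open>Only the two neighbours of \<open>j\<close> acquire new neighbours. For them, smoothness
  after the deletion gives smoothness before by the triangle inequality; the converse is additivity
  along two successive smooth points, where the absence of 4-cuts enters.\<close>

lemma smooth_delete_at:
  assumes "xs \<in> chains n" "smooth xs j"
  shows "smooth (delete_at j xs) i \<longleftrightarrow> smooth xs (skip j i)"
proof (cases "1 \<le> i \<and> Suc (Suc i) < length xs")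
  case False
  then show ?thesis
    using assms(2) by (auto simp: smooth_at_def skip_def length_delete_at)
next
  case True
  note c = chainsD[OF assms(1)]
  have j: "1 \<le> j" "j < n" "strictly_between d (xs ! (j - 1)) (xs ! j) (xs ! Suc j)"
    using assms(2) c(1) by (auto simp: smooth_at_def)
  have len: "length (delete_at j xs) = n"
    using c(1) j by (simp add: length_delete_at)
  have i: "1 \<le> i" "Suc i < n" using True c(1) by auto
  have del: "smooth (delete_at j xs) i \<longleftrightarrow>
      strictly_between d (xs ! skip j (i - 1)) (xs ! skip j i) (xs ! skip j (Suc i))"
    using i j c(1) len by (simp add: smooth_at_def nth_delete_at)
  consider "Suc i < j" | "Suc i = j" | "i = j" | "j < i" by linarith
  then show ?thesis
  proof cases
    case 1
    then show ?thesis
      unfolding del using i c(1) by (cases i) (simp_all add: skip_def smooth_at_def)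
  next
    case 4
    then show ?thesis
      unfolding del using i c(1) by (cases i) (simp_all add: skip_def smooth_at_def)
  next
    case 2
    let ?a = "xs ! (i - 1)" and ?b = "xs ! i" and ?c = "xs ! j" and ?e = "xs ! Suc j"
    have M: "?a \<in> M" "?b \<in> M" "?c \<in> M" "?e \<in> M" using c(2) i j 2 by auto
    have sb: "strictly_between d ?b ?c ?e" using j 2 by auto
    have "strictly_between d ?a ?b ?e \<longleftrightarrow> strictly_between d ?a ?b ?c"
    proof
      assume abe: "strictly_between d ?a ?b ?e"
      then have "d ?a ?b + d ?b ?e = d ?a ?e" "d ?b ?c + d ?c ?e = d ?b ?e"
        using sb by (simp_all add: strictly_between_def)
      then have "d ?a ?b + d ?b ?c = d ?a ?c"
        using triangle[OF M(1,3,4)] triangle[OF M(1,2,3)] by linarith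
      then show "strictly_between d ?a ?b ?c"
        using abe sb by (simp add: strictly_between_def)
    next
      assume abc: "strictly_between d ?a ?b ?c"
      then have "smooth xs i" using i 2 c(1) by (auto simp: smooth_at_def)
      then have "smooth xs r" if "i - 1 < r" "r < Suc j" for r
      proof -
        have "r = i \<or> r = j" using that i 2 by linarith
        then show ?thesis using assms(2) \<open>smooth xs i\<close> by blast
      qed
      then show "strictly_between d ?a ?b ?e"
        using i j 2 by (intro smooth_run_between[OF assms(1)]) auto
    qed
    then show ?thesis
      unfolding del using i c(1) 2 by (cases i) (simp_all add: skip_def smooth_at_def)
  next
    case 3
    let ?a = "xs ! (i - 1)" and ?b = "xs ! i" and ?c = "xs ! Suc i" and ?e = "xs ! Suc (Suc i)"
    have M: "?a \<in> M" "?b \<in> M" "?c \<in> M" "?e \<in> M" using c(2) i j 3 by auto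
    have sb: "strictly_between d ?a ?b ?c" using j 3 by auto
    have "strictly_between d ?a ?c ?e \<longleftrightarrow> strictly_between d ?b ?c ?e"
    proof
      assume ace: "strictly_between d ?a ?c ?e"
      then have "d ?a ?c + d ?c ?e = d ?a ?e" "d ?a ?b + d ?b ?c = d ?a ?c"
        using sb by (simp_all add: strictly_between_def)
      then have "d ?b ?c + d ?c ?e = d ?b ?e"
        using triangle[OF M(1,2,4)] triangle[OF M(2,3,4)] by linarith
      then show "strictly_between d ?b ?c ?e"
        using ace sb by (simp add: strictly_between_def)
    next
      assume "strictly_between d ?b ?c ?e"
      then have "smooth xs (Suc i)" using i c(1) by (auto simp: smooth_at_def)
      then have "smooth xs r" if "i - 1 < r" "r < Suc (Suc i)" for r
      proof -
        have "r = j \<or> r = Suc i" using that i 3 by linarith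
        then show ?thesis using assms(2) \<open>smooth xs (Suc i)\<close> by blast
      qed
      then show "strictly_between d ?a ?c ?e"
        using i j by (intro smooth_run_between[OF assms(1)]) auto
    qed
    then show ?thesis
      unfolding del using i c(1) 3 by (cases i) (simp_all add: skip_def smooth_at_def)
  qed
qed

subsection \<open>The pivot of a chain whose frame is not thin\<close>

text \<open>This detects a nonempty interval after a frame point without computing the frame: a
  smooth successor lies in the interval up to the next frame point. It can also hold at smooth
  positions, but the least such position is singular by \<open>not_smooth_before\<close>.\<close>

definition thick_at :: "'a list \<Rightarrow> nat \<Rightarrow> bool"
  where "thick_at xs s \<longleftrightarrow>
    Suc s < length xs \<and> (smooth xs (Suc s) \<or> segment (xs ! s) (xs ! Suc s) \<noteq> {})"

definition thick :: "'a list \<Rightarrow> bool"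
  where "thick xs \<longleftrightarrow> (\<exists>s. thick_at xs s)"

text \<open>The positions of the first two consecutive frame points with a nonempty open segment
  between them.\<close>

definition start :: "'a list \<Rightarrow> nat"
  where "start xs = (LEAST s. thick_at xs s)"

definition stop :: "'a list \<Rightarrow> nat"
  where "stop xs = (LEAST t. start xs < t \<and> \<not> smooth xs t)"

text \<open>The choice depends only on the values of the two frame points, so deleting a point
  between them does not change the pivot.\<close>

definition pivot :: "'a list \<Rightarrow> 'a"
  where "pivot xs = (SOME p. p \<in> segment (xs ! start xs) (xs ! stop xs))"

definition marked :: "'a list \<Rightarrow> nat \<Rightarrow> bool"
  where "marked xs m \<longleftrightarrow> thick xs \<and> start xs < m \<and> m < stop xs \<and> xs ! m = pivot xs"

lemma thick_if_smooth:
  assumes "smooth xs i"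
  shows "thick xs"
proof -
  have "thick_at xs (i - 1)"
    using assms by (auto simp: thick_at_def smooth_at_def)
  then show ?thesis by (auto simp: thick_def)
qed

lemma start_stop:
  assumes "xs \<in> chains n" "thick xs"
  shows thick_at_start: "thick_at xs (start xs)"
    and not_thick_before: "s < start xs \<Longrightarrow> \<not> thick_at xs s"
    and not_smooth_before: "r \<le> start xs \<Longrightarrow> \<not> smooth xs r"
    and start_less_stop: "start xs < stop xs"
    and not_smooth_stop: "\<not> smooth xs (stop xs)"
    and smooth_inside: "start xs < r \<Longrightarrow> r < stop xs \<Longrightarrow> smooth xs r"
    and stop_le: "stop xs \<le> n"
proof -
  show 1: "thick_at xs (start xs)"
    using assms(2) unfolding thick_def start_def by (rule LeastI_ex)
  show 2: "s < start xs \<Longrightarrow> \<not> thick_at xs s" for s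
    unfolding start_def by (rule not_less_Least)
  show "\<not> smooth xs r" if "r \<le> start xs"
  proof
    assume "smooth xs r"
    then have "thick_at xs (r - 1)" "1 \<le> r"
      by (auto simp: thick_at_def smooth_at_def)
    then show False using 2[of "r - 1"] that by (cases r) auto
  qed
  have len: "length xs = Suc n" using chainsD(1)[OF assms(1)] .
  \<comment> \<open>The last point of a chain is never smooth, so the search for \<open>stop\<close>
    succeeds.\<close>
  have ex: "start xs < n \<and> \<not> smooth xs n"
    using 1 len by (auto simp: thick_at_def smooth_at_def)
  show "start xs < stop xs" "\<not> smooth xs (stop xs)"
    using LeastI[of "\<lambda>t. start xs < t \<and> \<not> smooth xs t", OF ex] by (auto simp: stop_def)
  show "stop xs \<le> n"
    unfolding stop_def by (rule Least_le) (rule ex)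
  show "start xs < r \<Longrightarrow> r < stop xs \<Longrightarrow> smooth xs r"
    unfolding stop_def using not_less_Least by blast
qed

lemma inside_between:
  assumes "xs \<in> chains n" "thick xs" "start xs \<le> i" "i < j" "j < k" "k \<le> stop xs"
  shows "strictly_between d (xs ! i) (xs ! j) (xs ! k)"
  using assms start_stop[OF assms(1,2)]
  by (intro smooth_run_between[OF assms(1)]) auto

lemma inside_mono:
  assumes "xs \<in> chains n" "thick xs" "start xs < i" "i < j" "j \<le> stop xs"
  shows "d (xs ! start xs) (xs ! i) < d (xs ! start xs) (xs ! j)"
proof -
  have "strictly_between d (xs ! start xs) (xs ! i) (xs ! j)"
    using assms by (intro inside_between) auto
  moreover have "xs ! i \<in> M" "xs ! j \<in> M"
    using assms stop_le[OF assms(1,2)] chainsD(2)[OF assms(1)] by auto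
  ultimately show ?thesis
    using mdist_pos_less[of "xs ! i" "xs ! j"]
    by (auto simp: strictly_between_def simp del: mdist_pos_eq)
qed

text \<open>Either a smooth successor of \<open>start\<close> lies in the interval by
  \<open>inside_between\<close>, or \<open>stop\<close> is the next position and
  \<open>thick_at\<close> itself provides a point.\<close>

lemma pivot_in_segment:
  assumes "xs \<in> chains n" "thick xs"
  shows "pivot xs \<in> segment (xs ! start xs) (xs ! stop xs)"
proof -
  note st = start_stop[OF assms]
  have "segment (xs ! start xs) (xs ! stop xs) \<noteq> {}"
  proof (cases "smooth xs (Suc (start xs))")
    case True
    then have "Suc (start xs) < stop xs"
      using st(4,5) by (metis Suc_lessI)
    then have "strictly_between d (xs ! start xs) (xs ! Suc (start xs)) (xs ! stop xs)"
      using assms by (intro inside_between) auto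
    moreover have "xs ! Suc (start xs) \<in> M"
      using chainsD(2)[OF assms(1)] st(4,7) by auto
    ultimately show ?thesis by (auto simp: open_segment_of_def)
  next
    case False
    then have "stop xs = Suc (start xs)"
      using st(4,6) by (metis Suc_lessI lessI)
    then show ?thesis
      using st(1) False by (auto simp: thick_at_def)
  qed
  then show ?thesis
    unfolding pivot_def by (simp add: some_in_eq)
qed

text \<open>A smooth position lies beyond \<open>start\<close> and differs from \<open>stop\<close>,
  so the deletion spares both frame points; only the index of \<open>stop\<close> may shift.\<close>

lemma thick_delete_at:
  assumes "xs \<in> chains n" "smooth xs j"
  shows "thick (delete_at j xs)" "start (delete_at j xs) = start xs"
    "stop (delete_at j xs) = unskip j (stop xs)" "pivot (delete_at j xs) = pivot xs"
proof -
  let ?ys = "delete_at j xs"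
  have thick: "thick xs" using assms(2) by (rule thick_if_smooth)
  note c = chainsD[OF assms(1)] and st = start_stop[OF assms(1) thick]
  have j: "start xs < j" "j < n" "j \<noteq> stop xs"
    using assms(2) st(3)[of j] st(5) c(1) by (auto simp: smooth_at_def not_le[symmetric])
  have len: "length ?ys = n"
    using c(1) j by (simp add: length_delete_at)
  have same: "thick_at ?ys s \<longleftrightarrow> thick_at xs s" if "Suc s < j" for s
    using that j c(1) len
    by (simp add: thick_at_def smooth_delete_at[OF assms] nth_delete_at skip_def)
  have thick_start: "thick_at ?ys (start xs)"
  proof (cases "Suc (start xs) < j")
    case True
    then show ?thesis using same st(1) by simp
  next
    case False
    \<comment> \<open>Here the successor of \<open>start\<close> is deleted, and the deleted point
      itself witnesses that the interval to the new successor is nonempty.\<close>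
    then have eq: "j = Suc (start xs)" using j by simp
    then have "strictly_between d (xs ! start xs) (xs ! j) (xs ! Suc j)"
      using assms(2) by (simp add: smooth_at_def)
    then have "xs ! j \<in> segment (xs ! start xs) (xs ! Suc j)"
      using c(2) j by (simp add: open_segment_of_def)
    then show ?thesis
      using eq j len c(1) by (auto simp: thick_at_def nth_delete_at skip_def)
  qed
  then show "thick ?ys" by (auto simp: thick_def)
  show start: "start ?ys = start xs"
    unfolding start_def[of ?ys]
  proof (rule Least_equality)
    show "thick_at ?ys (start xs)" by (rule thick_start)
    show "start xs \<le> s" if "thick_at ?ys s" for s
      using same[of s] that st(2)[of s] j(1) by (cases "s < start xs") auto
  qed
  show stop: "stop ?ys = unskip j (stop xs)"
    unfolding stop_def[of ?ys] start
  proof (rule Least_equality)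
    show "start xs < unskip j (stop xs) \<and> \<not> smooth ?ys (unskip j (stop xs))"
      using st(4,5) j by (auto simp: smooth_delete_at[OF assms] skip_unskip) (auto simp: unskip_def)
    fix t assume t: "start xs < t \<and> \<not> smooth ?ys t"
    then have "\<not> smooth xs (skip j t)" "start xs < skip j t"
      by (auto simp: smooth_delete_at[OF assms] skip_def)
    then have "stop xs \<le> skip j t"
      using st(6) not_le_imp_less by blast
    then show "unskip j (stop xs) \<le> t"
      by (auto simp: skip_def unskip_def split: if_splits)
  qed
  have "?ys ! start xs = xs ! start xs"
    using j c(1) by (simp add: nth_delete_at skip_def)
  moreover have "?ys ! unskip j (stop xs) = xs ! skip j (unskip j (stop xs))"
    using j c(1) st(7) by (intro nth_delete_at) (auto simp: unskip_def)
  ultimately show "pivot ?ys = pivot xs"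
    using j by (simp add: pivot_def start stop skip_unskip)
qed

section \<open>Occurrences of the pivot and its unique insertion\<close>

lemma smooth_if_marked: "xs \<in> chains n \<Longrightarrow> marked xs m \<Longrightarrow> smooth xs m"
  using smooth_inside by (auto simp: marked_def)

text \<open>Distances from the start of the run strictly increase by \<open>inside_mono\<close>, so
  no point can recur in it.\<close>

lemma marked_unique:
  assumes "xs \<in> chains n" "marked xs m" "marked xs m'"
  shows "m = m'"
proof (rule ccontr)
  assume "m \<noteq> m'"
  then have "d (xs ! start xs) (xs ! m) \<noteq> d (xs ! start xs) (xs ! m')"
    using inside_mono[OF assms(1), of m m'] inside_mono[OF assms(1), of m' m] assms(2,3)
    by (cases "m < m'") (auto simp: marked_def)
  then show False
    using assms(2,3) by (simp add: marked_def)
qed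

lemma marked_delete_at:
  assumes "xs \<in> chains n" "smooth xs j" "marked xs m" "j \<noteq> m"
  shows "marked (delete_at j xs) (unskip j m)"
proof -
  note del = thick_delete_at[OF assms(1,2)] and c = chainsD[OF assms(1)]
  have thick: "thick xs" using assms(3) by (simp add: marked_def)
  note st = start_stop[OF assms(1) thick]
  have m: "start xs < m" "m < stop xs" "xs ! m = pivot xs"
    using assms(3) by (auto simp: marked_def)
  have j: "start xs < j" "j < n" "j \<noteq> stop xs"
    using assms(2) st(3)[of j] st(5) c(1) by (auto simp: smooth_at_def not_le[symmetric])
  have "delete_at j xs ! unskip j m = xs ! skip j (unskip j m)"
    using j m c(1) st(7) by (intro nth_delete_at) (auto simp: unskip_def)
  then have "delete_at j xs ! unskip j m = pivot xs"
    using assms(4) m by (simp add: skip_unskip)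
  moreover have "start xs < unskip j m" "unskip j m < unskip j (stop xs)"
    using j m assms(4) by (auto simp: unskip_def)
  ultimately show ?thesis
    by (simp add: marked_def del)
qed

text \<open>A mark in the shortened chain would lift through \<open>skip m\<close> to a second mark
  of \<open>xs\<close>.\<close>

lemma not_marked_delete_at:
  assumes "xs \<in> chains n" "marked xs m"
  shows "\<not> marked (delete_at m xs) k"
proof
  assume k: "marked (delete_at m xs) k"
  have sm: "smooth xs m" using assms by (rule smooth_if_marked)
  note del = thick_delete_at[OF assms(1) sm] and c = chainsD[OF assms(1)]
  have thick: "thick xs" using assms(2) by (simp add: marked_def)
  note st = start_stop[OF assms(1) thick]
  have m: "start xs < m" "m < stop xs"
    using assms(2) by (auto simp: marked_def)
  have k': "start xs < k" "k < stop xs - 1" "delete_at m xs ! k = pivot xs"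
    using k m by (auto simp: marked_def del unskip_def)
  then have "xs ! skip m k = pivot xs"
    using nth_delete_at[of m xs k] c(1) m st(7) by auto
  then have "marked xs (skip m k)"
    using k' thick by (auto simp: marked_def skip_def)
  then show False
    using marked_unique[OF assms] by (metis skip_neq)
qed

text \<open>If \<open>m < m'\<close>, the point at position \<open>m\<close> of the common face lies
  farther from the start than the pivot in \<open>ys\<close>, but nearer than the pivot in
  \<open>ys'\<close>. Both chains have the same start and pivot, so this is impossible.\<close>

lemma delete_marked_inject:
  assumes "ys \<in> chains n" "marked ys m" "ys' \<in> chains n" "marked ys' m'"
    and eq: "delete_at m ys = delete_at m' ys'"
  shows "m = m' \<and> ys = ys'"
proof -
  have less: False
    if A: "ys \<in> chains n" "marked ys m" "ys' \<in> chains n" "marked ys' m'" "m < m'"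
      "delete_at m ys = delete_at m' ys'" for ys ys' m m'
  proof -
    note c = chainsD[OF A(1)] and c' = chainsD[OF A(3)]
    have t: "thick ys" "thick ys'"
      using A by (auto simp: marked_def)
    note del = thick_delete_at[OF A(1) smooth_if_marked[OF A(1,2)]]
    note del' = thick_delete_at[OF A(3) smooth_if_marked[OF A(3,4)]]
    have start: "start ys' = start ys" using del(2) del'(2) A(6) by simp
    have pivot: "pivot ys' = pivot ys" using del(4) del'(4) A(6) by simp
    have m: "start ys < m" "m < stop ys" "ys ! m = pivot ys" "stop ys \<le> n"
      using A(2) stop_le[OF A(1) t(1)] by (auto simp: marked_def)
    have m': "start ys < m'" "m' < stop ys'" "ys' ! m' = pivot ys" "stop ys' \<le> n"
      using A(4) stop_le[OF A(3) t(2)] start pivot by (auto simp: marked_def)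
    have "delete_at m ys ! m = ys ! Suc m" "delete_at m' ys' ! m = ys' ! m"
      "delete_at m ys ! start ys = ys ! start ys" "delete_at m' ys' ! start ys = ys' ! start ys"
      using c(1) c'(1) m m' A(5) by (simp_all add: nth_delete_at skip_def)
    then have nths: "ys ! Suc m = ys' ! m" "ys ! start ys = ys' ! start ys"
      using A(6) by simp_all
    have "d (ys ! start ys) (ys ! m) < d (ys ! start ys) (ys ! Suc m)"
      using m by (intro inside_mono[OF A(1) t(1)]) auto
    moreover have "d (ys' ! start ys') (ys' ! m) < d (ys' ! start ys') (ys' ! m')"
      using m m' A(5) start by (intro inside_mono[OF A(3) t(2)]) auto
    ultimately show False
      using nths m m' start by simp
  qed
  have mm: "m = m'"
    using less[OF assms(1-4) _ eq] less[OF assms(3,4,1,2) _ eq[symmetric]] by (meson linorder_neqE_nat)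
  have t: "thick ys" "thick ys'"
    using assms by (auto simp: marked_def)
  note del = thick_delete_at(4)[OF assms(1) smooth_if_marked[OF assms(1,2)]]
  note del' = thick_delete_at(4)[OF assms(3) smooth_if_marked[OF assms(3,4)]]
  have "ys ! m = ys' ! m"
    using assms(2,4) del del' eq mm by (simp add: marked_def)
  moreover have "m < length ys"
    using smooth_at_less[OF smooth_if_marked[OF assms(1,2)]] by simp
  ultimately show ?thesis
    using delete_at_inject[of ys ys' m] chainsD(1)[OF assms(1)] chainsD(1)[OF assms(3)] eq mm by simp
qed

text \<open>The pivot is inserted before the first point of the run beyond it. Geodeticity places
  the predecessor before the pivot, which therefore becomes a smooth point.\<close>

lemma ex_marked_extension:
  assumes "xs \<in> chains n" "thick xs" "\<nexists>m. marked xs m"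
  shows "\<exists>ys m. ys \<in> chains (Suc n) \<and> marked ys m \<and> delete_at m ys = xs"
proof -
  note c = chainsD[OF assms(1)] and st = start_stop[OF assms(1,2)]
  let ?a = "xs ! start xs" and ?b = "xs ! stop xs" and ?p = "pivot xs"
  have p: "?p \<in> segment ?a ?b" using assms(1,2) by (rule pivot_in_segment)
  then have pM: "?p \<in> M" and apb: "d ?a ?p + d ?p ?b = d ?a ?b" "?a \<noteq> ?p" "?p \<noteq> ?b"
    by (auto simp: open_segment_of_def strictly_between_def)
  have neq_p: "xs ! i \<noteq> ?p" if "start xs \<le> i" "i \<le> stop xs" for i
    using that apb assms(2,3) by (cases "i = start xs"; cases "i = stop xs") (auto simp: marked_def)
  \<comment> \<open>\<open>?P k\<close> says that, seen from \<open>?a\<close>, the pivot precedes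
    \<open>xs ! k\<close>; \<open>stop xs\<close> qualifies, so a least such position
    exists.\<close>
  let ?P = "\<lambda>k. start xs < k \<and> k \<le> stop xs \<and> d ?a ?p + d ?p (xs ! k) = d ?a (xs ! k)"
  define k where "k = (LEAST k. ?P k)"
  have "?P (stop xs)" using apb st(4) by simp
  then have k: "start xs < k" "k \<le> stop xs" "d ?a ?p + d ?p (xs ! k) = d ?a (xs ! k)"
    using LeastI[of ?P] by (auto simp: k_def)
  have min: "\<not> ?P i" if "i < k" for i
    using that unfolding k_def by (rule not_less_Least)
  let ?u = "xs ! (k - 1)" and ?w = "xs ! k"
  have upw: "strictly_between d ?u ?p ?w"
  proof (cases "k - 1 = start xs")
    case True
    then show ?thesis
      using k apb(2) neq_p[of k] by (simp add: strictly_between_def)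
  next
    case False
    then have k1: "start xs < k - 1" "k - 1 < stop xs"
      using k by auto
    have "strictly_between d ?a ?u ?b"
      using k1 by (intro inside_between[OF assms(1,2)]) auto
    then have u: "?u \<in> segment ?a ?b"
      using c(2) k1 st(7) by (simp add: open_segment_of_def)
    \<comment> \<open>In the totally ordered segment, \<open>?p\<close> before \<open>?u\<close>
      would contradict the minimality of \<open>k\<close>, so \<open>?u\<close> comes first.\<close>
    have "total_on (segment ?a ?b) (segment_order M d ?a ?b)"
      using geodetic c(2) st(4,7) by (auto simp: geodetic_def linear_order_on_def)
    then have "(?u, ?p) \<in> segment_order M d ?a ?b \<or> (?p, ?u) \<in> segment_order M d ?a ?b"
      using u p neq_p[of "k - 1"] k1 by (auto simp: total_on_def)
    moreover have "(?p, ?u) \<notin> segment_order M d ?a ?b"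
      using min[of "k - 1"] k k1 by (auto simp: segment_order_def)
    ultimately have "d ?a ?u + d ?u ?p = d ?a ?p"
      by (auto simp: segment_order_def)
    moreover have "strictly_between d ?a ?u ?w"
      using k k1 by (intro inside_between[OF assms(1,2)]) auto
    \<comment> \<open>Subtracting \<open>d ?a ?u\<close> from
      \<open>d ?a ?p + d ?p ?w = d ?a ?w\<close> leaves
      \<open>d ?u ?p + d ?p ?w = d ?u ?w\<close>.\<close>
    ultimately show ?thesis
      using k neq_p[of k] neq_p[of "k - 1"] k1 by (auto simp: strictly_between_def)
  qed
  define ys where "ys = take k xs @ ?p # drop k xs"
  have kn: "k \<le> n" using k st(7) by simp
  have len: "length ys = Suc (Suc n)"
    using c(1) kn by (simp add: ys_def)
  have nth: "ys ! i = (if i < k then xs ! i else if i = k then ?p else xs ! (i - 1))"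
    if "i < length ys" for i
    using that c(1) kn by (auto simp: ys_def nth_append nth_Cons' min_def)
  have del: "delete_at k ys = xs"
    using c(1) kn by (simp add: ys_def delete_at_def)
  have sm: "smooth ys k"
    using upw k kn len by (auto simp: smooth_at_def nth)
  have ys: "ys \<in> chains (Suc n)"
  proof (rule chainsI)
    show "chain_length d ys = l"
      using chain_length_delete_at[OF sm] del c(4) by simp
    show "ys ! i \<in> M" if "i \<le> Suc n" for i
      using that len pM c(2)[of i] c(2)[of "i - 1"] kn by (auto simp: nth)
    show "ys ! i \<noteq> ys ! Suc i" if "i < Suc n" for i
    proof -
      consider "Suc i < k" | "Suc i = k" | "i = k" | "k < i" by linarith
      then show ?thesis
      proof cases
        case 4
        then show ?thesis using c(3)[of "i - 1"] that len by (cases i) (simp_all add: nth)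
      qed (use upw that len c(3)[of i] kn in \<open>auto simp: nth strictly_between_def\<close>)
    qed
  qed (simp add: len)
  \<comment> \<open>As \<open>xs\<close> is a face of \<open>ys\<close>, the start, stop and pivot
    of \<open>ys\<close> can be read off backwards from those of \<open>xs\<close>.\<close>
  note dl = thick_delete_at[OF ys sm, unfolded del]
  have thick: "thick ys" using sm by (rule thick_if_smooth)
  have "stop ys \<noteq> k"
    using not_smooth_stop[OF ys thick] sm by auto
  moreover have "\<not> stop ys < k"
    using dl(3) k by (auto simp: unskip_def)
  ultimately have "marked ys k"
    using thick k dl(2,4) len kn by (auto simp: marked_def nth)
  then show ?thesis
    using ys del by blast
qed

subsection \<open>The boundary map and the contracting homotopy\<close>

lemma keys_face_sum:
  assumes "xs \<in> chains (Suc n)"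
  shows "Poly_Mapping.keys (face_sum d xs) \<subseteq> chains n"
  unfolding face_sum_def
  using delete_at_chains[OF assms] by (intro order_trans[OF keys_sum]) auto

lemma keys_boundary:
  assumes "Poly_Mapping.keys c \<subseteq> chains (Suc n)"
  shows "Poly_Mapping.keys (frag_extend (face_sum d) c) \<subseteq> chains n"
  using assms keys_face_sum by (intro order_trans[OF keys_frag_extend]) blast

lemma smooth_delete_at_eq:
  assumes "xs \<in> chains n" "smooth xs j"
  shows "{k. smooth xs k} - {j} = skip j ` {i. smooth (delete_at j xs) i}"
proof -
  have "k \<in> skip j ` {i. smooth (delete_at j xs) i}" if "smooth xs k" "k \<noteq> j" for k
    using that smooth_delete_at[OF assms]
    by (intro image_eqI[of _ _ "unskip j k"]) (auto simp: skip_unskip)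
  then show ?thesis
    using smooth_delete_at[OF assms] by auto
qed

text \<open>Positions of a face are renamed by positions of the original chain, so that double
  deletions are indexed by pairs of positions in one chain.\<close>

lemma sum_smooth_delete_at:
  assumes "xs \<in> chains n" "smooth xs j"
  shows "(\<Sum>i | smooth (delete_at j xs) i. f i) = (\<Sum>k \<in> {k. smooth xs k} - {j}. f (unskip j k))"
  unfolding smooth_delete_at_eq[OF assms]
  by (subst sum.reindex) (auto intro: inj_on_subset[OF inj_skip])

lemma frag_extend_face_sum:
  "frag_extend f (face_sum d xs) = (\<Sum>i | smooth xs i. frag_cmul ((-1) ^ i) (f (delete_at i xs)))"
  by (simp add: face_sum_def frag_extend_sum finite_smooth_at frag_extend_cmul)

lemma boundary_face_sum:
  assumes "xs \<in> chains n"
  shows "frag_extend (face_sum d) (face_sum d xs) = 0"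
proof -
  let ?S = "{i. smooth xs i}"
  \<comment> \<open>Double faces are indexed by positions \<open>j\<close>, \<open>k\<close> of
    \<open>xs\<close>; the zero diagonal completes the square of indices.\<close>
  define g where "g j k = (if j = k then 0 else
    frag_cmul ((-1) ^ (j + unskip j k)) (frag_of (delete_at (unskip j k) (delete_at j xs))))" for j k
  have "frag_extend (face_sum d) (face_sum d xs) = (\<Sum>j\<in>?S. \<Sum>k\<in>?S. g j k)"
    unfolding frag_extend_face_sum
  proof (rule sum.cong[OF refl])
    fix j assume "j \<in> ?S"
    then have j: "smooth xs j" by simp
    have "frag_cmul ((-1) ^ j) (face_sum d (delete_at j xs)) = (\<Sum>k\<in>?S - {j}. g j k)"
      unfolding face_sum_def sum_smooth_delete_at[OF assms j] frag_cmul_sum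
      by (intro sum.cong) (auto simp: g_def power_add)
    also have "\<dots> = (\<Sum>k\<in>?S. g j k)"
      by (intro sum.mono_neutral_left finite_smooth_at) (auto simp: g_def)
    finally show "frag_cmul ((-1) ^ j) (face_sum d (delete_at j xs)) = (\<Sum>k\<in>?S. g j k)" .
  qed
  also have "\<dots> = 0"
  proof (rule sum_antisymmetric)
    fix j k assume "j \<in> ?S" "k \<in> ?S"
    then have "j < length xs" "k < length xs"
      by (auto dest: smooth_at_less)
    \<comment> \<open>Only the larger of the two positions is lowered by \<open>unskip\<close>, so
      the exponents differ by one.\<close>
    moreover have "(-1 :: int) ^ (j + unskip j k) = - ((-1) ^ (k + unskip k j))" if "j \<noteq> k"
    proof (cases "j < k")
      case True
      then show ?thesis by (cases k) (auto simp: unskip_def add.commute)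
    next
      case False
      then show ?thesis using that by (cases j) (auto simp: unskip_def add.commute)
    qed
    ultimately show "g j k = - g k j"
      using delete_at_unskip[of k j xs] by (auto simp: g_def)
  qed
  finally show ?thesis .
qed

lemma boundary_boundary:
  assumes "Poly_Mapping.keys c \<subseteq> chains n"
  shows "frag_extend (face_sum d) (frag_extend (face_sum d) c) = 0"
  using assms
  by (induction rule: frag_induction) (auto simp: boundary_face_sum frag_extend_diff)

section \<open>The homotopy that inserts a missing pivot\<close>

definition is_cone :: "'a list \<Rightarrow> 'a list \<Rightarrow> nat \<Rightarrow> bool"
  where "is_cone xs ys m \<longleftrightarrow> ys \<in> chains (length xs) \<and> marked ys m \<and> delete_at m ys = xs"

text \<open>Uniqueness of the described value comes from \<open>delete_marked_inject\<close>. The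
  default 0 covers thin chains and chains that already contain their pivot. In
  \<open>is_cone\<close>, the degree of the extension is \<open>length xs\<close> because a chain of
  degree n has n + 1 entries.\<close>

definition homotopy :: "'a list \<Rightarrow> 'a list \<Rightarrow>\<^sub>0 int"
  where "homotopy xs =
    (if \<exists>ys m. is_cone xs ys m
     then THE c. \<exists>ys m. is_cone xs ys m \<and> c = frag_cmul ((-1) ^ m) (frag_of ys)
     else 0)"

lemma homotopy_cone:
  assumes "is_cone xs ys m"
  shows "homotopy xs = frag_cmul ((-1) ^ m) (frag_of ys)"
proof -
  have uniq: "m' = m \<and> ys' = ys" if "is_cone xs ys' m'" for ys' m'
    using that assms delete_marked_inject unfolding is_cone_def by blast
  have "(THE c. \<exists>ys m. is_cone xs ys m \<and> c = frag_cmul ((-1) ^ m) (frag_of ys))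
      = frag_cmul ((-1) ^ m) (frag_of ys)"
  proof (rule the_equality)
    show "\<exists>ys' m'. is_cone xs ys' m' \<and>
        frag_cmul ((-1) ^ m) (frag_of ys) = frag_cmul ((-1) ^ m') (frag_of ys')"
      using assms by blast
    show "c = frag_cmul ((-1) ^ m) (frag_of ys)"
      if "\<exists>ys m. is_cone xs ys m \<and> c = frag_cmul ((-1) ^ m) (frag_of ys)" for c
      using that uniq by metis
  qed
  moreover have "\<exists>ys m. is_cone xs ys m" using assms by blast
  ultimately show ?thesis
    by (simp only: homotopy_def if_True)
qed

lemma homotopy_eq_0:
  assumes "\<And>ys m. \<not> is_cone xs ys m"
  shows "homotopy xs = 0"
  using assms by (simp add: homotopy_def)

lemma homotopy_marked:
  assumes "marked xs m"
  shows "homotopy xs = 0"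
proof (rule homotopy_eq_0)
  show "\<not> is_cone xs ys m'" for ys m'
    using assms not_marked_delete_at unfolding is_cone_def by blast
qed

lemma homotopy_thin:
  assumes "\<not> thick xs"
  shows "homotopy xs = 0"
proof (rule homotopy_eq_0)
  show "\<not> is_cone xs ys m" for ys m
    using assms thick_delete_at(1) smooth_if_marked unfolding is_cone_def by blast
qed

lemma keys_homotopy:
  assumes "xs \<in> chains n"
  shows "Poly_Mapping.keys (homotopy xs) \<subseteq> chains (Suc n)"
proof (cases "\<exists>ys m. is_cone xs ys m")
  case True
  then obtain ys m where cone: "is_cone xs ys m" by blast
  then show ?thesis
    using homotopy_cone[OF cone] chainsD(1)[OF assms] by (auto simp: is_cone_def)
next
  case False
  then show ?thesis by (simp add: homotopy_eq_0)
qed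

definition thin_part :: "'a list \<Rightarrow> 'a list \<Rightarrow>\<^sub>0 int"
  where "thin_part xs = (if thick xs then 0 else frag_of xs)"

text \<open>Every face that keeps the pivot is killed by \<open>homotopy\<close>; the cone over the
  remaining face is \<open>xs\<close>, and the sign \<open>(-1) ^ m\<close> occurs twice.\<close>

lemma boundary_homotopy_marked:
  assumes "xs \<in> chains n" "marked xs m"
  shows "frag_extend homotopy (face_sum d xs) = frag_of xs"
proof -
  let ?S = "{i. smooth xs i}"
  have m: "m \<in> ?S" using smooth_if_marked[OF assms] by simp
  have "length (delete_at m xs) = n"
    using m chainsD(1)[OF assms(1)] by (auto simp: length_delete_at dest: smooth_at_less)
  then have cone: "is_cone (delete_at m xs) xs m"
    using assms by (simp add: is_cone_def)
  have "frag_extend homotopy (face_sum d xs)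
      = (\<Sum>i\<in>{m}. frag_cmul ((-1) ^ i) (homotopy (delete_at i xs)))"
    unfolding frag_extend_face_sum
  proof (rule sum.mono_neutral_right[OF finite_smooth_at])
    show "\<forall>i\<in>?S - {m}. frag_cmul ((-1) ^ i) (homotopy (delete_at i xs)) = 0"
      using marked_delete_at[OF assms(1) _ assms(2)] homotopy_marked by auto
  qed (use m in auto)
  also have "\<dots> = frag_cmul ((-1) ^ m * (-1) ^ m) (frag_of xs)"
    by (simp add: homotopy_cone[OF cone])
  finally show ?thesis by (simp flip: power_add mult_2)
qed

text \<open>The face of the cone without the pivot is \<open>xs\<close>. Each other face of the cone
  is the cone over a face of \<open>xs\<close>, and the two resulting terms have opposite
  signs.\<close>

lemma boundary_homotopy_cone:
  assumes "xs \<in> chains n" "is_cone xs ys m"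
  shows "frag_extend (face_sum d) (homotopy xs) + frag_extend homotopy (face_sum d xs) = frag_of xs"
proof -
  have len: "length xs = Suc n" using chainsD(1)[OF assms(1)] .
  have ys: "ys \<in> chains (Suc n)" "marked ys m" "delete_at m ys = xs"
    using assms(2) len by (auto simp: is_cone_def)
  have m: "smooth ys m" using smooth_if_marked[OF ys(1,2)] .
  have leny: "length ys = Suc (Suc n)" using chainsD(1)[OF ys(1)] .
  let ?S = "{i. smooth ys i}"
  let ?f = "\<lambda>i. frag_cmul ((-1) ^ m * (-1) ^ i) (frag_of (delete_at i ys))"
  have "frag_extend (face_sum d) (homotopy xs) = (\<Sum>i\<in>?S. ?f i)"
    by (simp add: homotopy_cone[OF assms(2)] frag_extend_cmul face_sum_def frag_cmul_sum)
  also have "\<dots> = ?f m + (\<Sum>i\<in>?S - {m}. ?f i)"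
    using m by (intro sum.remove finite_smooth_at) auto
  also have "?f m = frag_of xs"
    by (simp add: ys flip: power_add mult_2)
  finally have 1: "frag_extend (face_sum d) (homotopy xs) = frag_of xs + (\<Sum>i\<in>?S - {m}. ?f i)" .
  have "frag_extend homotopy (face_sum d xs)
      = (\<Sum>i\<in>?S - {m}. frag_cmul ((-1) ^ unskip m i) (homotopy (delete_at (unskip m i) xs)))"
    unfolding frag_extend_face_sum
    using sum_smooth_delete_at[OF ys(1) m] by (simp add: ys(3))
  also have "\<dots> = (\<Sum>i\<in>?S - {m}. - ?f i)"
  proof (rule sum.cong[OF refl])
    fix i assume "i \<in> ?S - {m}"
    then have i: "smooth ys i" "i \<noteq> m" by auto
    have ilen: "i < length ys" "m < length ys"
      using i m by (auto dest: smooth_at_less)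
    have "delete_at (unskip i m) (delete_at i ys) = delete_at (unskip m i) xs"
      using delete_at_unskip[of m i ys] i ilen ys(3) by simp
    moreover have "length (delete_at (unskip m i) xs) = n"
      using i ilen m len leny by (auto simp: length_delete_at unskip_def)
    ultimately have "is_cone (delete_at (unskip m i) xs) (delete_at i ys) (unskip i m)"
      using delete_at_chains[OF ys(1) i(1)] marked_delete_at[OF ys(1) i(1) ys(2) i(2)]
      by (simp add: is_cone_def)
    note h = homotopy_cone[OF this]
    \<comment> \<open>Again exactly one of the two indices is lowered, which produces the
      sign.\<close>
    have "(-1 :: int) ^ unskip m i * (-1) ^ unskip i m = - ((-1) ^ m * (-1) ^ i)"
    proof (cases "i < m")
      case True
      then show ?thesis by (cases m) (auto simp: unskip_def)
    next
      case False
      then show ?thesis using i(2) by (cases i) (auto simp: unskip_def)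
    qed
    then show "frag_cmul ((-1) ^ unskip m i) (homotopy (delete_at (unskip m i) xs)) = - ?f i"
      by (simp add: h)
  qed
  also have "\<dots> = - (\<Sum>i\<in>?S - {m}. ?f i)"
    by (rule sum_negf)
  finally show ?thesis
    unfolding 1 by simp
qed

lemma face_sum_thin:
  assumes "\<not> thick xs"
  shows "face_sum d xs = 0"
proof -
  have "{i. smooth xs i} = {}"
    using assms thick_if_smooth by blast
  then show ?thesis by (simp add: face_sum_def)
qed

text \<open>A thin chain survives only in \<open>thin_part\<close>, a chain containing its pivot is
  recovered from its faces, and any other thick chain has a cone.\<close>

lemma homotopy_formula:
  assumes "xs \<in> chains n"
  shows "frag_extend (face_sum d) (homotopy xs) + frag_extend homotopy (face_sum d xs) + thin_part xs
    = frag_of xs"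
proof (cases "thick xs")
  case False
  then show ?thesis
    by (simp add: homotopy_thin face_sum_thin thin_part_def)
next
  case thick: True
  show ?thesis
  proof (cases "\<exists>m. marked xs m")
    case True
    then obtain m where m: "marked xs m" by blast
    show ?thesis
      using thick by (simp add: boundary_homotopy_marked[OF assms m] homotopy_marked[OF m] thin_part_def)
  next
    case False
    then obtain ys m where "is_cone xs ys m"
      using ex_marked_extension[OF assms thick] chainsD(1)[OF assms] unfolding is_cone_def by metis
    from boundary_homotopy_cone[OF assms this] show ?thesis
      using thick by (simp add: thin_part_def)
  qed
qed

lemma homotopy_formula_extend:
  assumes "Poly_Mapping.keys c \<subseteq> chains n"
  shows "frag_extend (face_sum d) (frag_extend homotopy c)
    + frag_extend homotopy (frag_extend (face_sum d) c) + frag_extend thin_part c = c"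
  using assms
proof (induction rule: frag_induction)
  case (diff a b)
  let ?f = "\<lambda>c. frag_extend (face_sum d) (frag_extend homotopy c)
    + frag_extend homotopy (frag_extend (face_sum d) c) + frag_extend thin_part c"
  have "?f (a - b) = ?f a - ?f b"
    by (simp only: frag_extend_diff add_diff_add)
  then show ?case
    by (simp only: diff)
qed (auto simp: homotopy_formula)

text \<open>Faces are thick by \<open>thick_delete_at\<close>, so the projection kills each of
  them.\<close>

lemma thin_part_boundary:
  assumes "Poly_Mapping.keys c \<subseteq> chains n"
  shows "frag_extend thin_part (frag_extend (face_sum d) c) = 0"
  using assms
proof (induction rule: frag_induction)
  case (one xs)
  then have "thin_part (delete_at i xs) = 0" if "smooth xs i" for i
    using thick_delete_at(1) that by (simp add: thin_part_def)
  then show ?case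
    by (simp add: frag_extend_face_sum)
qed (auto simp: frag_extend_diff)

section \<open>Thin frames as a basis of the homology\<close>

lemma thin_frame_iff:
  assumes "xs \<in> chains n"
  shows "thin_frame M d xs \<longleftrightarrow> \<not> thick xs"
proof
  have len: "length xs = Suc n" using chainsD(1)[OF assms] .
  {
    assume "thin_frame M d xs"
    then have fr: "frame d xs = xs" and seg: "\<forall>i\<in>{1..n}. segment (xs ! (i - 1)) (xs ! i) = {}"
      using len by (auto simp: thin_frame_def proper_chains_def)
    \<comment> \<open>Comparing lengths shows that \<open>frame\<close> drops no index, hence that
      no position is smooth.\<close>
    have "card {i. i < length xs \<and> i \<in> {i. \<not> smooth xs i}} = card {..<length xs}"
      using fr length_nths[of xs "{i. \<not> smooth xs i}"] by (simp add: frame_def)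
    then have "{i. i < length xs \<and> i \<in> {i. \<not> smooth xs i}} = {..<length xs}"
      by (intro card_subset_eq) auto
    then have "\<not> smooth xs i" for i
      using smooth_at_less[of d xs i] Suc_lessD by blast
    moreover have "segment (xs ! s) (xs ! Suc s) = {}" if "Suc s < length xs" for s
      using seg[rule_format, of "Suc s"] that len by simp
    ultimately show "\<not> thick xs"
      by (auto simp: thick_def thick_at_def)
  }
  assume thin: "\<not> thick xs"
  have "{i. \<not> smooth xs i} = UNIV"
    using thick_if_smooth thin by blast
  then have "frame d xs = xs"
    by (simp add: frame_def nths_all)
  moreover have "segment (xs ! (i - 1)) (xs ! i) = {}" if "i \<in> {1..n}" for i
    using thin that len by (cases i) (auto simp: thick_def thick_at_def)
  moreover have "xs \<in> proper_chains M n"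
    using assms by (simp add: proper_chains_of_length_def)
  ultimately show "thin_frame M d xs"
    unfolding thin_frame_def by blast
qed

text \<open>The first isomorphism theorem is applied to the projection restricted to cycles: it is
  onto, and its kernel consists of the boundaries.\<close>

lemma homology_iso:
  "magnitude_homology M d n l \<cong>
    free_Abelian_group {F \<in> chains n. thin_frame M d F}" (is "_ \<cong> ?T")
proof -
  let ?C = "magnitude_chain_group M d n l" and ?Z = "magnitude_cycles M d n l"
  let ?B = "magnitude_boundaries M d n l" and ?h = "frag_extend thin_part"
  let ?D = "frag_extend (face_sum d)"
  have Z: "c \<in> ?Z \<longleftrightarrow> Poly_Mapping.keys c \<subseteq> chains n \<and> ?D c = 0" for c
    by (auto simp: magnitude_cycles_def magnitude_chain_group_def magnitude_boundary_eq)
  have B: "?B = ?D ` {c. Poly_Mapping.keys c \<subseteq> chains (Suc n)}"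
    unfolding magnitude_boundaries_def magnitude_chain_group_def
    by (intro image_cong) (auto simp: magnitude_boundary_eq)
  interpret C: group ?C by (simp add: magnitude_chain_group_def)
  have subgroup: "subgroup ?Z ?C"
  proof (rule C.subgroupI)
    show "?Z \<subseteq> carrier ?C" by (auto simp: magnitude_cycles_def)
    show "?Z \<noteq> {}" using Z[of 0] by auto
    show "inv\<^bsub>?C\<^esub> a \<in> ?Z" if "a \<in> ?Z" for a
      using that by (simp add: Z magnitude_chain_group_def frag_extend_minus)
    show "a \<otimes>\<^bsub>?C\<^esub> b \<in> ?Z" if "a \<in> ?Z" "b \<in> ?Z" for a b
      using that keys_add[of a b] by (auto simp: Z magnitude_chain_group_def frag_extend_add)
  qed
  let ?ZG = "subgroup_generated ?C ?Z"
  have carrier: "carrier ?ZG = ?Z"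
    using subgroup by (rule subgroup.carrier_subgroup_generated_subgroup)
  have thin_keys: "Poly_Mapping.keys (?h c) \<subseteq> {F \<in> chains n. thin_frame M d F}"
    if "Poly_Mapping.keys c \<subseteq> chains n" for c
  proof -
    have "Poly_Mapping.keys (thin_part xs) \<subseteq> {F \<in> chains n. thin_frame M d F}"
      if "xs \<in> chains n" for xs
      using that by (simp add: thin_part_def thin_frame_iff)
    then show ?thesis
      using that by (intro order_trans[OF keys_frag_extend]) blast
  qed
  have "?h \<in> hom ?ZG ?T"
  proof (rule homI)
    show "?h c \<in> carrier ?T" if "c \<in> carrier ?ZG" for c
      using that thin_keys[of c] unfolding carrier Z by simp
  qed (simp add: magnitude_chain_group_def frag_extend_add)
  then interpret h: group_hom ?ZG ?T ?h
    by (simp add: group_hom_def group_hom_axioms_def)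
  \<comment> \<open>Combinations of thin frames are cycles fixed by the projection, hence their own
    preimages.\<close>
  have fixed: "?h c = c \<and> c \<in> ?Z" if "Poly_Mapping.keys c \<subseteq> {F \<in> chains n. thin_frame M d F}" for c
  proof -
    have "?h c = frag_extend frag_of c"
      using that by (intro frag_extend_eq) (auto simp: thin_part_def thin_frame_iff)
    moreover have "?D c = 0"
    proof (rule frag_extend_eq_0)
      fix xs assume "xs \<in> Poly_Mapping.keys c"
      then show "face_sum d xs = 0"
        using that thin_frame_iff face_sum_thin by blast
    qed
    ultimately show ?thesis
      using that by (auto simp: Z simp flip: frag_expansion)
  qed
  have "?h ` carrier ?ZG = carrier ?T"
  proof
    show "?h ` carrier ?ZG \<subseteq> carrier ?T"
      by (rule image_subsetI) (rule h.hom_closed)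
    show "carrier ?T \<subseteq> ?h ` carrier ?ZG"
    proof
      fix c assume "c \<in> carrier ?T"
      then have "?h c = c" "c \<in> ?Z"
        using fixed[of c] by simp_all
      then show "c \<in> ?h ` carrier ?ZG"
        unfolding carrier by (metis imageI)
    qed
  qed
  then have "?ZG Mod kernel ?ZG ?T ?h \<cong> ?T"
    by (rule h.FactGroup_iso)
  moreover have "kernel ?ZG ?T ?h = ?B"
  proof
    show "kernel ?ZG ?T ?h \<subseteq> ?B"
    proof
      fix c assume "c \<in> kernel ?ZG ?T ?h"
      then have c: "Poly_Mapping.keys c \<subseteq> chains n" "?D c = 0" "?h c = 0"
        by (auto simp: kernel_def carrier Z)
      \<comment> \<open>For a cycle killed by the projection, two of the three terms of the homotopy
        formula vanish.\<close>
      then have "c = ?D (frag_extend homotopy c)"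
        using homotopy_formula_extend[OF c(1)] by simp
      moreover have "Poly_Mapping.keys (frag_extend homotopy c) \<subseteq> chains (Suc n)"
        using c(1) keys_homotopy by (intro order_trans[OF keys_frag_extend]) blast
      ultimately show "c \<in> ?B"
        unfolding B by blast
    qed
    show "?B \<subseteq> kernel ?ZG ?T ?h"
    proof
      fix b assume "b \<in> ?B"
      then obtain c where "Poly_Mapping.keys c \<subseteq> chains (Suc n)" "b = ?D c"
        unfolding B by blast
      then have "b \<in> ?Z" "?h b = 0"
        unfolding Z by (simp_all only: keys_boundary boundary_boundary thin_part_boundary simp_thms)
      then show "b \<in> kernel ?ZG ?T ?h"
        by (simp add: kernel_def carrier)
    qed
  qed
  ultimately show ?thesis
    by (simp add: magnitude_homology_def)
qed

end

theorem theorem5p2: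
  fixes X :: "'a set" and d :: "'a \<Rightarrow> 'a \<Rightarrow> real" and l :: real and n :: nat
  assumes "Metric_space X d"
    and "geodetic X d"
    and "0 < l"
    and "ereal l < min_cut_length X d"
  shows "magnitude_homology X d n l \<cong>
    free_Abelian_group {F \<in> proper_chains_of_length X d n l. thin_frame X d F}"
proof -
  interpret short_chains X d l
    using assms by (simp add: short_chains_def short_chains_axioms_def)
  show ?thesis by (rule homology_iso)
qed

end
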